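(* Let $(f_r)_{r\in\mathbb{N}}$ be a sequence of functions $f_r\colon\mathbb{N}\to\mathbb{C}$. Assume that i) $f_r$ is $r$-even for every $r\in\mathbb{N}$, ii) for every $n\in\mathbb{N}$ the function $r\mapsto f_r(n)$ is multiplicative. Then 1) for every $n\in\mathbb{N}$ the function $r\mapsto\widehat{f}_r(n)$ is multiplicative; 2) the function $\widehat{f}\colon\mathbb{N}^2\to\mathbb{C}$, $\widehat{f}(n,r)=\widehat{f}_r(n)$, is multiplicative as a function of two variables; 3) $\widehat{f}_r(m)\widehat{f}_r(n)=f_r'(r)\,\widehat{f}_r(mn)$ holds for any $m,n,r\in\mathbb{N}$ with $\gcd(m,n)=1$; 4) (for each $r\in\mathbb{N}$) the function $n\mapsto\widehat{f}_r(n)$ is multiplicative if and only if $f_r'(r)=1$.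
   Context: $\mathbb{N}=\{1,2,\ldots\}$. A function $f\colon\mathbb{N}\to\mathbb{C}$ is $r$-even if $f(\gcd(n,r))=f(n)$ for all $n\in\mathbb{N}$ (in particular it is $r$-periodic). For an $r$-periodic function $f$ its discrete Fourier transform is $\widehat{f}(n)=\sum_{k=1}^{r}f(k)\exp(-2\pi i kn/r)$, $n\in\mathbb{N}$; $\widehat{f}_r$ denotes the discrete Fourier transform (with modulus $r$) of $f_r$. A function $g\colon\mathbb{N}\to\mathbb{C}$ is multiplicative if $g(1)=1$ and $g(mn)=g(m)g(n)$ whenever $\gcd(m,n)=1$. A function $f\colon\mathbb{N}^2\to\mathbb{C}$ is multiplicative as a function of two variables if $f(mn,rs)=f(m,r)f(n,s)$ for all $m,n,r,s\in\mathbb{N}$ with $\gcd(mr,ns)=1$. For $f\colon\mathbb{N}\to\mathbb{C}$, $f'=\mu*f$, where $\mu$ is the Möbius function and $(f*g)(n)=\sum_{d\mid n}f(d)g(n/d)$; thus $f_r'=\mu*f_r$. *)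

theory Defs
  imports "HOL-Analysis.Analysis" "HOL-Computational_Algebra.Computational_Algebra"
begin

text \<open>
  Arithmetic functions have domain \<open>nat\<close>, but represent functions on the positive integers:
  values at 0 never enter any of the notions below.
\<close>

definition even_mod :: "nat \<Rightarrow> (nat \<Rightarrow> complex) \<Rightarrow> bool" where
  "even_mod r f \<longleftrightarrow> (\<forall>n>0. f (gcd n r) = f n)"

definition dft :: "nat \<Rightarrow> (nat \<Rightarrow> complex) \<Rightarrow> nat \<Rightarrow> complex" where
  "dft r f n = (\<Sum>k=1..r. f k * exp (- 2 * of_real pi * \<i> * of_nat k * of_nat n / of_nat r))"

definition mult_fun :: "(nat \<Rightarrow> complex) \<Rightarrow> bool" where
  "mult_fun g \<longleftrightarrow> g 1 = 1 \<and> (\<forall>m>0. \<forall>n>0. coprime m n \<longrightarrow> g (m * n) = g m * g n)"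

text \<open>No condition is imposed on the value at (1, 1).\<close>

definition mult_fun2 :: "(nat \<Rightarrow> nat \<Rightarrow> complex) \<Rightarrow> bool" where
  "mult_fun2 f \<longleftrightarrow> (\<forall>m>0. \<forall>n>0. \<forall>r>0. \<forall>s>0.
     coprime (m * r) (n * s) \<longrightarrow> f (m * n) (r * s) = f m r * f n s)"

definition moebius :: "nat \<Rightarrow> complex" where
  "moebius n = (if squarefree n then (- 1) ^ card (prime_factors n) else 0)"

definition dirichlet_conv :: "(nat \<Rightarrow> complex) \<Rightarrow> (nat \<Rightarrow> complex) \<Rightarrow> nat \<Rightarrow> complex" where
  "dirichlet_conv f g n = (\<Sum>d | d dvd n. f d * g (n div d))"

definition moebius_transform :: "(nat \<Rightarrow> complex) \<Rightarrow> nat \<Rightarrow> complex" where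
  "moebius_transform f = dirichlet_conv moebius f"

end

theory Submission
  imports Defs "HOL-Number_Theory.Cong"
begin

text \<open>
  Since \<open>f\<^sub>r(k)\<close> depends only on \<open>gcd k r\<close>, the transform is a sum over all residues modulo \<open>r\<close> of
  \<open>f\<^sub>r(gcd k r) \<zeta>\<^sub>r\<^bsup>kn\<^esup>\<close>, where \<open>\<zeta>\<^sub>r = exp(-2\<pi>\<i>/r)\<close>. Three facts about this sum carry the whole theorem.

  \<^item> Writing the residues modulo \<open>rs\<close> as \<open>as + br\<close> (Chinese remainder theorem) splits both factors of the
    summand when \<open>r\<close> and \<open>s\<close> are coprime, so the transform is multiplicative in the modulus
    (\<open>dft_mult_coprime_modulus\<close>).

  \<^item> If \<open>n\<close> is coprime to \<open>r\<close>, multiplication by \<open>n\<close> permutes the residues and preserves their gcd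
    with \<open>r\<close>, so the transform takes the same value at \<open>mn\<close> and \<open>m\<close> (\<open>dft_even_mult_coprime\<close>).

  \<^item> The value at 1 is \<open>f'\<^sub>r(r)\<close>: expand \<open>f\<^sub>r(gcd k r)\<close> as the sum of \<open>f'\<^sub>r(d)\<close> over the common divisors
    \<open>d\<close> of \<open>k\<close> and \<open>r\<close>; for fixed \<open>d\<close> the roots of unity cancel unless \<open>d = r\<close>
    (\<open>dft_even_at_1\<close>).

  The first two facts give multiplicativity in one and in two variables. For the product formula they
  allow a reduction to a prime power modulus; there one of the coprime arguments \<open>m\<close>, \<open>n\<close> is prime to
  the modulus and can be replaced by 1, where the third fact applies
  (\<open>product_at_coprime_arguments\<close>). Finally \<open>f'\<^sub>r(r)\<close> is at once the value at 1 and the factor in the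
  product formula, so it equals 1 exactly when the transform is multiplicative in its argument.
\<close>

section \<open>Roots of unity\<close>

text \<open>
  The minus sign is that of the Fourier kernel, so \<open>zeta r ^ (k * n)\<close> is the factor that multiplies \<open>f k\<close>
  in the transform at \<open>n\<close>.
\<close>

definition zeta :: "nat \<Rightarrow> complex" where
  "zeta r = exp (- 2 * of_real pi * \<i> / of_nat r)"

lemma zeta_power: "zeta r ^ k = exp (- 2 * of_real pi * \<i> * of_nat k / of_nat r)"
  unfolding zeta_def exp_of_nat_mult[symmetric] by (simp add: field_simps)

lemma zeta_power_self: "r > 0 \<Longrightarrow> zeta r ^ r = 1"
  by (simp add: zeta_power exp_minus)

lemma zeta_power_mod: "r > 0 \<Longrightarrow> zeta r ^ (k mod r) = zeta r ^ k"
proof -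
  assume r: "r > 0"
  have "zeta r ^ k = zeta r ^ (r * (k div r) + k mod r)" by simp
  also have "\<dots> = zeta r ^ (k mod r)"
    by (simp only: power_add power_mult zeta_power_self[OF r] power_one mult_1)
  finally show ?thesis by simp
qed

lemma zeta_mult_power: "d > 0 \<Longrightarrow> zeta (d * q) ^ d = zeta q"
  by (simp add: zeta_power) (simp add: zeta_def)

lemma zeta_eq_1_imp:
  assumes "zeta q = 1" "q > 0"
  shows "q = 1"
proof -
  from assms(1) obtain n :: int where n: "- 2 * pi / real q = of_int (2 * n) * pi"
    unfolding zeta_def exp_eq_1 by (auto simp: Im_divide_of_nat)
  hence "- 2 * pi = of_int (2 * n) * pi * real q"
    using assms(2) by (simp add: field_simps)
  hence "pi * (- 1) = pi * (of_int n * real q)" by (simp add: algebra_simps)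
  hence "of_int n * real q = - 1" unfolding mult_cancel_left by simp
  hence "of_int (n * int q) = (of_int (-1) :: real)" by simp
  hence "n * int q = -1" unfolding of_int_eq_iff .
  hence "int q dvd -1" by (metis dvd_triv_right)
  thus ?thesis by simp
qed

lemma sum_zeta_powers:
  assumes "q > 0"
  shows "(\<Sum>j<q. zeta q ^ j) = (if q = 1 then 1 else 0)"
proof (cases "q = 1")
  case False
  then have "zeta q \<noteq> 1" using zeta_eq_1_imp assms by blast
  then show ?thesis using False assms by (simp add: geometric_sum zeta_power_self)
qed simp

section \<open>Moebius inversion\<close>

lemma moebius_mult_prime:
  assumes p: "prime p" and d: "d > 0" "\<not> p dvd d"
  shows "moebius (p * d) = - moebius d"
proof -
  have c: "coprime p d" using p d by (simp add: prime_imp_coprime)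
  have sf: "squarefree (p * d) \<longleftrightarrow> squarefree d"
    using squarefree_mult_coprime[OF c] squarefree_prime[OF p] squarefree_multD(2) by blast
  have pf: "prime_factors (p * d) = insert p (prime_factors d)"
    using p d by (auto simp: prime_factors_product prime_prime_factors prime_gt_0_nat)
  have "p \<notin> prime_factors d" using d by auto
  then show ?thesis unfolding moebius_def sf pf by simp
qed

text \<open>
  For a prime \<open>p\<close> dividing \<open>n\<close>, multiplication by \<open>p\<close> maps the divisors prime to \<open>p\<close> onto those divisible
  by \<open>p\<close> exactly once and flips the sign of the Moebius function, which vanishes on all other divisors.
\<close>

lemma sum_moebius_divisors:
  assumes n: "n > 0"
  shows "(\<Sum>d | d dvd n. moebius d) = (if n = 1 then 1 else 0)"
proof (cases "n = 1")
  case True then show ?thesis by (simp add: moebius_def)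
next
  case False
  then obtain p where p: "prime p" "p dvd n" using prime_factor_nat by blast
  have fin: "finite {d. d dvd n}" using n by simp
  let ?A = "{d. d dvd n \<and> \<not> p dvd d}"
  let ?B = "{d. d dvd n \<and> p dvd d \<and> \<not> p * p dvd d}"
  let ?C = "{d. d dvd n \<and> p * p dvd d}"
  have U: "{d. d dvd n} = ?A \<union> (?B \<union> ?C)" by (auto dest: dvd_mult_left)
  have C0: "(\<Sum>d\<in>?C. moebius d) = 0"
  proof (rule sum.neutral, clarify)
    fix d assume "p * p dvd d"
    hence "\<not> squarefree d"
      using p(1) unfolding squarefree_def power2_eq_square by (meson not_prime_unit)
    thus "moebius d = 0" by (simp add: moebius_def)
  qed
  have "(\<Sum>d\<in>?B. moebius d) = (\<Sum>d\<in>?A. - moebius d)"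
  proof (rule sum.reindex_bij_witness[of _ "\<lambda>d. p * d" "\<lambda>d. d div p"])
    fix d assume "d \<in> ?B"
    then obtain c where c: "d = p * c" "p * c dvd n" "\<not> p * p dvd p * c" by auto
    have p0: "p > 0" using p(1) by (simp add: prime_gt_0_nat)
    have c': "\<not> p dvd c" using c(3) p0 by auto
    show "p * (d div p) = d" "d div p \<in> ?A"
      using c c' p0 by (auto dest: dvd_mult_right)
    have "c > 0" using c' by (rule contrapos_np) simp
    then show "- moebius (d div p) = moebius d" using c(1) c' p0 moebius_mult_prime[OF p(1)] by simp
  next
    fix d assume d: "d \<in> ?A"
    have p0: "p > 0" using p(1) by (simp add: prime_gt_0_nat)
    show "p * d div p = d" using p0 by simp
    have "p * d dvd n" using d p by (auto intro!: divides_mult simp: prime_imp_coprime)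
    then show "p * d \<in> ?B" using d p0 by auto
  qed
  moreover have "(\<Sum>d | d dvd n. moebius d) = (\<Sum>d\<in>?A. moebius d) + ((\<Sum>d\<in>?B. moebius d) + (\<Sum>d\<in>?C. moebius d))"
  proof -
    have f: "finite ?A" "finite ?B" "finite ?C" by (rule finite_subset[OF _ fin]; blast)+
    show ?thesis unfolding U
      by (subst sum.union_disjoint; (subst sum.union_disjoint)?; use f in \<open>auto dest: dvd_mult_left\<close>)
  qed
  ultimately show ?thesis using C0 False by (simp add: sum_negf)
qed

text \<open>
  Exchanging summations collects, for each divisor \<open>c\<close> of \<open>n\<close>, the Moebius sum over the divisors of
  \<open>n div c\<close>, which is nonzero only for \<open>c = n\<close>.
\<close>

lemma moebius_inversion:
  assumes n: "n > 0"
  shows "(\<Sum>d | d dvd n. moebius_transform f d) = f n"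
proof -
  have fin: "finite {d. d dvd m}" if "m > 0" for m :: nat using that by simp
  have "(\<Sum>d | d dvd n. moebius_transform f d)
      = (\<Sum>(d, e) \<in> (SIGMA d:{d. d dvd n}. {e. e dvd d}). moebius e * f (d div e))"
    unfolding moebius_transform_def dirichlet_conv_def
    by (rule sum.Sigma) (use fin n dvd_pos_nat in \<open>simp, blast\<close>)
  \<comment> \<open>\<open>c\<close> is the cofactor \<open>d div e\<close> at which \<open>f\<close> is evaluated.\<close>
  also have "\<dots> = (\<Sum>(c, e) \<in> (SIGMA c:{c. c dvd n}. {e. e dvd n div c}). moebius e * f c)"
  proof (rule sum.reindex_bij_witness[of _ "\<lambda>(c, e). (c * e, e)" "\<lambda>(d, e). (d div e, e)"], goal_cases)
    case (1 x)
    then show ?case using n by (auto elim!: dvdE)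
  next
    case (2 x)
    then show ?case using n by (auto elim!: dvdE)
  next
    case (3 x)
    then show ?case using n by (auto elim!: dvdE)
  next
    case (4 x)
    then show ?case using n by (auto elim!: dvdE)
  next
    case (5 x)
    then show ?case by auto
  qed
  also have "\<dots> = (\<Sum>c | c dvd n. \<Sum>e | e dvd n div c. moebius e * f c)"
    by (rule sum.Sigma[symmetric]) (use n in \<open>auto elim!: dvdE\<close>)
  also have "\<dots> = (\<Sum>c | c dvd n. if c = n then f c else 0)"
  proof (rule sum.cong[OF refl])
    fix c assume "c \<in> {c. c dvd n}"
    then obtain k where k: "n = c * k" by auto
    then have pos: "c > 0" "k > 0" using n by auto
    have "(\<Sum>e | e dvd n div c. moebius e * f c) = (\<Sum>e | e dvd k. moebius e) * f c"
      using k pos by (simp add: sum_distrib_right)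
    then show "(\<Sum>e | e dvd n div c. moebius e * f c) = (if c = n then f c else 0)"
      using sum_moebius_divisors[OF pos(2)] k pos by simp
  qed
  also have "\<dots> = f n" using n by simp
  finally show ?thesis .
qed

section \<open>The Fourier transform of an even function\<close>

lemma even_mod_gcd: "even_mod r f \<Longrightarrow> n > 0 \<Longrightarrow> f (gcd n r) = f n"
  by (simp add: even_mod_def)

text \<open>
  Putting \<open>gcd k r\<close> for \<open>k\<close> makes the summand depend on \<open>k\<close> modulo \<open>r\<close> only, also at \<open>k = 0\<close>, where
  \<open>gcd 0 r = r\<close>, while \<open>f 0\<close> itself is arbitrary. The range can then be the standard residues below \<open>r\<close>.
\<close>

lemma dft_even:
  assumes "even_mod r f" and r: "r > 0"
  shows "dft r f n = (\<Sum>k<r. f (gcd k r) * zeta r ^ (k * n))"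
proof -
  have "dft r f n = (\<Sum>k=1..r. f (gcd k r) * zeta r ^ (k * n))"
    unfolding dft_def
    by (rule sum.cong) (simp_all add: even_mod_gcd[OF assms(1)] zeta_power mult.assoc)
  also have "{1..r} = insert r {1..<r}" using r by auto
  also have "(\<Sum>k\<in>insert r {1..<r}. f (gcd k r) * zeta r ^ (k * n))
      = (\<Sum>k\<in>insert 0 {1..<r}. f (gcd k r) * zeta r ^ (k * n))"
    using r by (simp add: power_mult zeta_power_self)
  also have "insert 0 {1..<r} = {..<r}" using r by auto
  finally show ?thesis .
qed

lemma gcd_mult_mod_coprime:
  fixes a n r :: nat
  assumes "coprime n r"
  shows "gcd (a * n mod r) r = gcd a r"
  using assms by (metis gcd_mod_left gcd_mult_left_right_cancel coprime_commute gcd.commute gcd_red_nat)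

text \<open>
  The substitution \<open>k \<mapsto> k n\<close> permutes the residues and changes no \<open>gcd k r\<close>; it moves the factor \<open>n\<close> from
  the argument into the summation index.
\<close>

lemma dft_even_mult_coprime:
  assumes "even_mod r f" and r: "r > 0" and c: "coprime n r"
  shows "dft r f (m * n) = dft r f m"
proof -
  have inj: "inj_on (\<lambda>k. k * n mod r) {..<r}"
  proof (rule inj_onI)
    fix a b assume ab: "a \<in> {..<r}" "b \<in> {..<r}" "a * n mod r = b * n mod r"
    hence "[a = b] (mod r)" using c cong_mult_rcancel_nat[of n r a b] by (simp add: cong_def coprime_commute)
    thus "a = b" using ab by (simp add: cong_def)
  qed
  moreover have sub: "(\<lambda>k. k * n mod r) ` {..<r} \<subseteq> {..<r}" using r by auto
  ultimately have img: "(\<lambda>k. k * n mod r) ` {..<r} = {..<r}"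
    by (intro endo_inj_surj) auto
  have "dft r f m = (\<Sum>k\<in>(\<lambda>k. k * n mod r) ` {..<r}. f (gcd k r) * zeta r ^ (k * m))"
    unfolding dft_even[OF assms(1) r] img ..
  also have "\<dots> = (\<Sum>k<r. f (gcd (k * n mod r) r) * zeta r ^ (k * n mod r * m))"
    by (simp add: sum.reindex[OF inj])
  also have "\<dots> = (\<Sum>k<r. f (gcd k r) * zeta r ^ (k * (m * n)))"
  proof (rule sum.cong[OF refl])
    fix k
    have "zeta r ^ (k * n mod r * m) = zeta r ^ (k * (m * n))"
      by (simp only: power_mult zeta_power_mod[OF r]) (simp only: power_mult[symmetric] mult.assoc mult.commute mult.left_commute)
    then show "f (gcd (k * n mod r) r) * zeta r ^ (k * n mod r * m) = f (gcd k r) * zeta r ^ (k * (m * n))"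
      by (simp only: gcd_mult_mod_coprime[OF c])
  qed
  finally show ?thesis by (simp add: dft_even[OF assms(1) r])
qed

text \<open>
  By Moebius inversion \<open>f (gcd k r)\<close> is a sum over the common divisors of \<open>k\<close> and \<open>r\<close>. For \<open>r = d q\<close>, the
  coefficient of \<open>moebius_transform f d\<close> is the sum of \<open>zeta r ^ k\<close> over the multiples \<open>k\<close> of \<open>d\<close>. These powers
  run through all the \<open>q\<close>-th roots of unity, so their sum vanishes unless \<open>q = 1\<close>.
\<close>

lemma dft_even_at_1:
  assumes "even_mod r f" and r: "r > 0"
  shows "dft r f 1 = moebius_transform f r"
proof -
  let ?g = "moebius_transform f"
  have fin: "finite {d. d dvd r}" using r by simp
  have "dft r f 1 = (\<Sum>k<r. \<Sum>d | d dvd r. if d dvd k then ?g d * zeta r ^ k else 0)"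
    unfolding dft_even[OF assms]
  proof (rule sum.cong[OF refl])
    fix k
    have "f (gcd k r) * zeta r ^ (k * 1) = (\<Sum>d | d dvd gcd k r. ?g d) * zeta r ^ k"
      using r moebius_inversion[of "gcd k r" f] by (simp del: gcd_greatest_iff)
    also have "\<dots> = (\<Sum>d | d dvd gcd k r. ?g d * zeta r ^ k)" by (simp add: sum_distrib_right)
    also have "{d. d dvd gcd k r} = {d \<in> {d. d dvd r}. d dvd k}" by auto
    also have "(\<Sum>d\<in>\<dots>. ?g d * zeta r ^ k) = (\<Sum>d | d dvd r. if d dvd k then ?g d * zeta r ^ k else 0)"
      by (rule sum.inter_filter[OF fin])
    finally show "f (gcd k r) * zeta r ^ (k * 1) = \<dots>" .
  qed
  also have "\<dots> = (\<Sum>d | d dvd r. \<Sum>k<r. if d dvd k then ?g d * zeta r ^ k else 0)"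
    by (rule sum.swap)
  also have "\<dots> = (\<Sum>d | d dvd r. if d = r then ?g d else 0)"
  proof (rule sum.cong[OF refl])
    fix d assume "d \<in> {d. d dvd r}"
    then obtain q where q: "r = d * q" by auto
    with r have pos: "d > 0" "q > 0" by auto
    have "(\<Sum>k<r. if d dvd k then ?g d * zeta r ^ k else 0) = (\<Sum>k\<in>{k\<in>{..<r}. d dvd k}. ?g d * zeta r ^ k)"
      by (rule sum.inter_filter[symmetric]) simp
    also have "\<dots> = (\<Sum>j<q. ?g d * zeta r ^ (d * j))"
      by (rule sum.reindex_bij_witness[of _ "\<lambda>j. d * j" "\<lambda>k. k div d"])
        (use q pos in \<open>auto elim!: dvdE\<close>)
    also have "\<dots> = ?g d * (\<Sum>j<q. zeta q ^ j)"
      by (simp add: sum_distrib_left power_mult q zeta_mult_power pos)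
    also have "\<dots> = (if d = r then ?g d else 0)"
      using q pos by (simp add: sum_zeta_powers)
    finally show "(\<Sum>k<r. if d dvd k then ?g d * zeta r ^ k else 0) = \<dots>" .
  qed
  also have "\<dots> = ?g r" using r fin by simp
  finally show ?thesis .
qed

text \<open>
  This parametrization, rather than the one by the pair of residues, is the one under which
  \<open>zeta (r * s)\<close> factors into a power of \<open>zeta r\<close> and a power of \<open>zeta s\<close>.
\<close>

lemma bij_betw_chinese:
  fixes r s :: nat
  assumes c: "coprime r s" and r: "r > 0" and s: "s > 0"
  shows "bij_betw (\<lambda>(a, b). (a * s + b * r) mod (r * s)) ({..<r} \<times> {..<s}) {..<r * s}"
proof -
  let ?h = "\<lambda>(a, b). (a * s + b * r) mod (r * s)"
  have inj: "inj_on ?h ({..<r} \<times> {..<s})"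
  proof (rule inj_onI, clarify)
    fix a b a' b'
    assume lt: "a < r" "b < s" "a' < r" "b' < s"
      and eq: "(a * s + b * r) mod (r * s) = (a' * s + b' * r) mod (r * s)"
    have 1: "[a * s + b * r = a' * s + b' * r] (mod r * s)" using eq by (simp add: cong_def)
    from cong_dvd_modulus_nat[OF 1, of r] have "[a * s = a' * s] (mod r)" by (simp add: cong_def)
    hence "[a = a'] (mod r)" using c by (simp add: cong_mult_rcancel_nat coprime_commute)
    moreover from cong_dvd_modulus_nat[OF 1, of s] have "[b * r = b' * r] (mod s)" by (simp add: cong_def)
    hence "[b = b'] (mod s)" using c by (simp add: cong_mult_rcancel_nat coprime_commute)
    ultimately show "a = a' \<and> b = b'" using lt by (simp add: cong_def)
  qed
  moreover have "?h ` ({..<r} \<times> {..<s}) \<subseteq> {..<r * s}" using r s by auto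
  ultimately have "?h ` ({..<r} \<times> {..<s}) = {..<r * s}"
    by (intro card_subset_eq) (auto simp: card_image card_cartesian_product)
  with inj show ?thesis by (simp add: bij_betw_def)
qed

text \<open>
  At \<open>k = a s + b r\<close> both factors of the summand split: \<open>gcd k r = gcd a r\<close> and \<open>gcd k s = gcd b s\<close> because
  \<open>r\<close> and \<open>s\<close> are coprime, and \<open>zeta (r * s) ^ k = zeta r ^ a * zeta s ^ b\<close>.
\<close>

lemma dft_mult_coprime_modulus:
  assumes c: "coprime r s" and r: "r > 0" and s: "s > 0"
    and f: "even_mod r f" and g: "even_mod s g" and h: "even_mod (r * s) h"
    and fg: "\<And>n. n > 0 \<Longrightarrow> h n = f n * g n"
  shows "dft (r * s) h n = dft r f n * dft s g n"
proof -
  let ?F = "\<lambda>k. f (gcd k r) * zeta r ^ (k * n)" and ?G = "\<lambda>k. g (gcd k s) * zeta s ^ (k * n)"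
  let ?H = "\<lambda>k. h (gcd k (r * s)) * zeta (r * s) ^ (k * n)"
  have rs: "r * s > 0" using r s by simp
  have *: "?H ((a * s + b * r) mod (r * s)) = ?F a * ?G b" for a b
  proof -
    let ?k = "a * s + b * r"
    have "gcd (gcd ?k (r * s)) r = gcd ?k r" "gcd (gcd ?k (r * s)) s = gcd ?k s"
      by (simp_all add: gcd.assoc)
    moreover have "gcd ?k r = gcd a r"
      using gcd_mult_mod_coprime[of s r a] c gcd_red_nat[of ?k r]
      by (simp add: coprime_commute gcd.commute)
    moreover have "gcd ?k s = gcd b s"
      using gcd_mult_mod_coprime[of r s b] c gcd_red_nat[of ?k s]
      by (simp add: gcd.commute)
    moreover have pos: "gcd ?k (r * s) > 0" using rs by simp
    ultimately have 1: "h (gcd ?k (r * s)) = f (gcd a r) * g (gcd b s)"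
      using fg[OF pos] even_mod_gcd[OF f pos] even_mod_gcd[OF g pos] by simp
    have "zeta (r * s) ^ (?k mod (r * s) * n) = zeta (r * s) ^ (?k * n)"
      by (simp only: power_mult zeta_power_mod[OF rs])
    also have "\<dots> = (zeta (s * r) ^ s) ^ (a * n) * (zeta (r * s) ^ r) ^ (b * n)"
      by (simp add: power_add power_mult[symmetric] algebra_simps)
    also have "\<dots> = zeta r ^ (a * n) * zeta s ^ (b * n)"
      by (simp only: zeta_mult_power[OF r] zeta_mult_power[OF s])
    finally have "zeta (r * s) ^ (?k mod (r * s) * n) = zeta r ^ (a * n) * zeta s ^ (b * n)" .
    moreover have "gcd (?k mod (r * s)) (r * s) = gcd ?k (r * s)"
      using gcd_red_nat[of ?k "r * s"] by (simp add: gcd.commute)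
    ultimately show ?thesis by (simp only: 1 mult.assoc mult.left_commute)
  qed
  have "dft (r * s) h n = (\<Sum>x\<in>{..<r} \<times> {..<s}. ?H ((\<lambda>(a, b). (a * s + b * r) mod (r * s)) x))"
    unfolding dft_even[OF h rs] by (rule sum.reindex_bij_betw[OF bij_betw_chinese[OF c r s], symmetric])
  also have "\<dots> = (\<Sum>(a, b)\<in>{..<r} \<times> {..<s}. ?F a * ?G b)"
    by (rule sum.cong) (auto simp only: * split: prod.splits)
  also have "\<dots> = dft r f n * dft s g n"
    unfolding dft_even[OF f r] dft_even[OF g s] by (simp add: sum_product sum.cartesian_product)
  finally show ?thesis .
qed

section \<open>The product formula at coprime arguments\<close>

text \<open>
  Both sides are multiplicative in the modulus, so prime powers can be split off
  one by one. A power of \<open>p\<close> is coprime to \<open>m\<close> or to \<open>n\<close>; if to \<open>n\<close>, then \<open>n\<close> may be replaced by 1 and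
  \<open>m * n\<close> by \<open>m\<close>, and the two sides agree.
\<close>

lemma product_at_coprime_arguments:
  fixes F :: "nat \<Rightarrow> nat \<Rightarrow> complex"
  assumes one: "\<And>n. n > 0 \<Longrightarrow> F 1 n = 1"
    and mult: "\<And>r s n. \<lbrakk>r > 0; s > 0; n > 0; coprime r s\<rbrakk> \<Longrightarrow> F (r * s) n = F r n * F s n"
    and inv: "\<And>r m n. \<lbrakk>r > 0; m > 0; n > 0; coprime n r\<rbrakk> \<Longrightarrow> F r (m * n) = F r m"
    and mn: "m > 0" "n > 0" "coprime m n"
    and "r > 0"
  shows "F r m * F r n = F r 1 * F r (m * n)"
  using \<open>r > 0\<close>
proof (induction r rule: less_induct)
  case (less r)
  show ?case
  proof (cases "r = 1")
    case True then show ?thesis using one mn by simp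
  next
    case False
    then obtain p where p: "prime p" "p dvd r" using prime_factor_nat by blast
    obtain s where s: "r = p ^ multiplicity p r * s" "\<not> p dvd s"
      using multiplicity_decompose'[of r p] p less.prems by (metis not_prime_unit not_gr_zero)
    define q where "q = p ^ multiplicity p r"
    have "multiplicity p r > 0"
      using p less.prems not_prime_unit[of p] by (intro multiplicity_gt_zero_iff[THEN iffD2]) auto
    then have q1: "q > 1"
      unfolding q_def using prime_gt_1_nat[OF p(1)] by (intro one_less_power)
    have rq: "r = q * s" using s by (simp add: q_def)
    have s0: "s > 0" using s(2) by (rule contrapos_np) simp
    have "s < r" using q1 s0 by (simp add: rq)
    note IH = less.IH[OF this s0]
    have c: "coprime q s" using p s by (simp add: q_def prime_imp_coprime)
    have Q: "F q m * F q n = F q 1 * F q (m * n)"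
    proof (cases "p dvd n")
      case False
      then have "coprime n q"
        using prime_imp_coprime[OF p(1), of n] by (simp add: q_def coprime_commute)
      then show ?thesis using inv[of q m n] inv[of q 1 n] q1 mn by simp
    next
      case True
      then have "\<not> p dvd m" using mn p by (meson coprime_common_divisor not_prime_unit)
      then have "coprime m q"
        using prime_imp_coprime[OF p(1), of m] by (simp add: q_def coprime_commute)
      then show ?thesis using inv[of q n m] inv[of q 1 m] q1 mn by (simp add: mult.commute)
    qed
    have M: "F r k = F q k * F s k" if "k > 0" for k
      unfolding rq using mult c q1 s0 that by simp
    have "F r m * F r n = (F q m * F q n) * (F s m * F s n)" using M mn by simp
    also have "\<dots> = (F q 1 * F q (m * n)) * (F s 1 * F s (m * n))" unfolding Q IH ..
    also have "\<dots> = F r 1 * F r (m * n)" using M mn by simp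
    finally show ?thesis .
  qed
qed

theorem proposition5:
  fixes f :: "nat \<Rightarrow> nat \<Rightarrow> complex"  \<comment> \<open>\<open>f r n\<close> stands for \<open>f\<^sub>r(n)\<close>\<close>
  assumes even: "\<And>r. r > 0 \<Longrightarrow> even_mod r (f r)"
    and mult: "\<And>n. n > 0 \<Longrightarrow> mult_fun (\<lambda>r. f r n)"
  shows "(\<forall>n>0. mult_fun (\<lambda>r. dft r (f r) n))
    \<and> mult_fun2 (\<lambda>n r. dft r (f r) n)
    \<and> (\<forall>m>0. \<forall>n>0. \<forall>r>0. coprime m n \<longrightarrow>
          dft r (f r) m * dft r (f r) n = moebius_transform (f r) r * dft r (f r) (m * n))
    \<and> (\<forall>r>0. mult_fun (dft r (f r)) \<longleftrightarrow> moebius_transform (f r) r = 1)"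
proof -
  let ?F = "\<lambda>r n. dft r (f r) n"
  have one: "?F 1 n = 1" for n
    using dft_even[OF even[of 1], of n] mult[of 1] by (simp add: mult_fun_def)
  have modulus: "?F (r * s) n = ?F r n * ?F s n" if "r > 0" "s > 0" "coprime r s" for r s n
    using that mult by (intro dft_mult_coprime_modulus even) (auto simp: mult_fun_def)
  have arg: "?F r (m * n) = ?F r m" if "r > 0" "coprime n r" for r m n
    using dft_even_mult_coprime even that by blast
  have at_1: "?F r 1 = moebius_transform (f r) r" if "r > 0" for r
    using dft_even_at_1 even that by blast
  have prod: "?F r m * ?F r n = moebius_transform (f r) r * ?F r (m * n)"
    if "m > 0" "n > 0" "r > 0" "coprime m n" for m n r
    using product_at_coprime_arguments[of ?F m n r, OF one modulus arg] that at_1 by simp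
  have "mult_fun (\<lambda>r. ?F r n)" for n
    using one modulus by (simp add: mult_fun_def)
  moreover have "mult_fun2 (\<lambda>n r. ?F r n)"
    unfolding mult_fun2_def
  proof (intro allI impI)
    fix m n r s :: nat
    assume pos: "m > 0" "n > 0" "r > 0" "s > 0" and c: "coprime (m * r) (n * s)"
    have "coprime r s" "coprime n r" "coprime m s" using c by (auto simp: coprime_commute)
    then show "?F (r * s) (m * n) = ?F r m * ?F s n"
      using modulus[of r s] arg[of r n m] arg[of s m n] pos by (simp add: mult.commute)
  qed
  moreover have "mult_fun (?F r) \<longleftrightarrow> moebius_transform (f r) r = 1" if "r > 0" for r
    using prod at_1 that by (auto simp: mult_fun_def)
  ultimately show ?thesis using prod by blast
qed

end
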